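(* Let $G$ be an $\omega$-stable group acting (by automorphisms) on a simplicial tree $T$. Then the action is trivial, i.e. $G$ contains no hyperbolic element: every $g\in G$ is either an inversion or elliptic.
   Context: A graph consists of vertices $V$, edges $E$ and a map $e\mapsto (o(e),t(e),\bar e)$ with $\bar{\bar e}=e$, $\bar e\neq e$, $o(e)=t(\bar e)$; a simplicial tree is a connected graph without circuits. A group acts on a tree if it acts by graph automorphisms. An element $g$ is an inversion if $ge=\bar e$ for some edge $e$, elliptic if $gv=v$ for some vertex $v$, and hyperbolic if it is neither. The action is called trivial if $G$ has no hyperbolic elements. *)

theory Defs
  imports "HOL-Algebra.Group_Action" "HOL-Library.Countable_Set"
begin

section \<open>First-order logic\<close>

text \<open>
  A symbol is a name together with its arity: \<open>(f, n) \<in> Funs L\<close> says that \<open>f\<close> is an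
  \<open>n\<close>-ary function symbol of \<open>L\<close>.  Equality is a logical symbol.
\<close>

record ('f, 'r) language =
  Funs :: "('f \<times> nat) set"
  Rels :: "('r \<times> nat) set"

record ('f, 'r, 'a) fo_struct =
  univ :: "'a set"
  Fint :: "'f \<Rightarrow> 'a list \<Rightarrow> 'a"
  Rint :: "'r \<Rightarrow> 'a list \<Rightarrow> bool"

definition is_structure :: "('f, 'r) language \<Rightarrow> ('f, 'r, 'a) fo_struct \<Rightarrow> bool" where
  "is_structure L M \<longleftrightarrow> univ M \<noteq> {} \<and>
     (\<forall>(f, n) \<in> Funs L. \<forall>xs. length xs = n \<and> set xs \<subseteq> univ M \<longrightarrow> Fint M f xs \<in> univ M)"

text \<open>\<open>Par a\<close> is the constant naming the element \<open>a\<close>; it occurs in formulas with parameters.\<close>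

datatype ('f, 'a) trm = Var nat | Par 'a | Fn 'f "('f, 'a) trm list"

datatype ('f, 'r, 'a) form =
    Equal "('f, 'a) trm" "('f, 'a) trm"
  | Rel 'r "('f, 'a) trm list"
  | Neg "('f, 'r, 'a) form"
  | Conj "('f, 'r, 'a) form" "('f, 'r, 'a) form"
  | Exi nat "('f, 'r, 'a) form"

primrec trm_ok :: "('f, 'r) language \<Rightarrow> ('f, 'a) trm \<Rightarrow> bool" where
  "trm_ok L (Var i) \<longleftrightarrow> True"
| "trm_ok L (Par a) \<longleftrightarrow> True"
| "trm_ok L (Fn f ts) \<longleftrightarrow> (f, length ts) \<in> Funs L \<and> list_all (trm_ok L) ts"

primrec trm_vars :: "('f, 'a) trm \<Rightarrow> nat set" where
  "trm_vars (Var i) = {i}"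
| "trm_vars (Par a) = {}"
| "trm_vars (Fn f ts) = \<Union> (set (map trm_vars ts))"

primrec trm_params :: "('f, 'a) trm \<Rightarrow> 'a set" where
  "trm_params (Var i) = {}"
| "trm_params (Par a) = {a}"
| "trm_params (Fn f ts) = \<Union> (set (map trm_params ts))"

primrec trm_val :: "('f, 'r, 'a) fo_struct \<Rightarrow> (nat \<Rightarrow> 'a) \<Rightarrow> ('f, 'a) trm \<Rightarrow> 'a" where
  "trm_val M e (Var i) = e i"
| "trm_val M e (Par a) = a"
| "trm_val M e (Fn f ts) = Fint M f (map (trm_val M e) ts)"

primrec form_ok :: "('f, 'r) language \<Rightarrow> ('f, 'r, 'a) form \<Rightarrow> bool" where
  "form_ok L (Equal s t) \<longleftrightarrow> trm_ok L s \<and> trm_ok L t"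
| "form_ok L (Rel r ts) \<longleftrightarrow> (r, length ts) \<in> Rels L \<and> list_all (trm_ok L) ts"
| "form_ok L (Neg p) \<longleftrightarrow> form_ok L p"
| "form_ok L (Conj p q) \<longleftrightarrow> form_ok L p \<and> form_ok L q"
| "form_ok L (Exi i p) \<longleftrightarrow> form_ok L p"

primrec free_vars :: "('f, 'r, 'a) form \<Rightarrow> nat set" where
  "free_vars (Equal s t) = trm_vars s \<union> trm_vars t"
| "free_vars (Rel r ts) = \<Union> (set (map trm_vars ts))"
| "free_vars (Neg p) = free_vars p"
| "free_vars (Conj p q) = free_vars p \<union> free_vars q"
| "free_vars (Exi i p) = free_vars p - {i}"

primrec params :: "('f, 'r, 'a) form \<Rightarrow> 'a set" where
  "params (Equal s t) = trm_params s \<union> trm_params t"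
| "params (Rel r ts) = \<Union> (set (map trm_params ts))"
| "params (Neg p) = params p"
| "params (Conj p q) = params p \<union> params q"
| "params (Exi i p) = params p"

primrec sat :: "('f, 'r, 'a) fo_struct \<Rightarrow> (nat \<Rightarrow> 'a) \<Rightarrow> ('f, 'r, 'a) form \<Rightarrow> bool" where
  "sat M e (Equal s t) \<longleftrightarrow> trm_val M e s = trm_val M e t"
| "sat M e (Rel r ts) \<longleftrightarrow> Rint M r (map (trm_val M e) ts)"
| "sat M e (Neg p) \<longleftrightarrow> \<not> sat M e p"
| "sat M e (Conj p q) \<longleftrightarrow> sat M e p \<and> sat M e q"
| "sat M e (Exi i p) \<longleftrightarrow> (\<exists>a \<in> univ M. sat M (e(i := a)) p)"

text \<open>The \<open>L(A)\<close>-formulas in the free variables \<open>0, \<dots>, n - 1\<close>.\<close>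

definition forms :: "('f, 'r) language \<Rightarrow> 'a set \<Rightarrow> nat \<Rightarrow> ('f, 'r, 'a) form set" where
  "forms L A n = {p. form_ok L p \<and> params p \<subseteq> A \<and> free_vars p \<subseteq> {..<n}}"

abbreviation sentences :: "('f, 'r) language \<Rightarrow> ('f, 'r, 'a) form set" where
  "sentences L \<equiv> forms L {} 0"

definition satisfies :: "('f, 'r, 'a) fo_struct \<Rightarrow> ('f, 'r, 'a) form \<Rightarrow> bool" where
  "satisfies M p \<longleftrightarrow> (\<forall>e. range e \<subseteq> univ M \<longrightarrow> sat M e p)"

definition Th :: "('f, 'r) language \<Rightarrow> ('f, 'r, 'a) fo_struct \<Rightarrow> ('f, 'r, 'a) form set" where
  "Th L M = {p \<in> sentences L. satisfies M p}"

definition is_model ::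
    "('f, 'r) language \<Rightarrow> ('f, 'r, 'a) fo_struct \<Rightarrow> ('f, 'r, 'a) form set \<Rightarrow> bool" where
  "is_model L N T \<longleftrightarrow> is_structure L N \<and> (\<forall>p \<in> T. satisfies N p)"


section \<open>Types and \<open>\<omega>\<close>-stability\<close>

definition finitely_satisfiable ::
    "('f, 'r, 'a) fo_struct \<Rightarrow> ('f, 'r, 'a) form set \<Rightarrow> bool" where
  "finitely_satisfiable N S \<longleftrightarrow>
     (\<forall>S0 \<subseteq> S. finite S0 \<longrightarrow> (\<exists>e. range e \<subseteq> univ N \<and> (\<forall>p \<in> S0. sat N e p)))"

text \<open>The set of complete \<open>n\<close>-types over \<open>A\<close> in \<open>N\<close>.\<close>

definition complete_types ::
    "('f, 'r) language \<Rightarrow> ('f, 'r, 'a) fo_struct \<Rightarrow> 'a set \<Rightarrow> nat \<Rightarrow> ('f, 'r, 'a) form set set" where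
  "complete_types L N A n =
     {S. S \<subseteq> forms L A n \<and> finitely_satisfiable N S \<and>
         (\<forall>p \<in> forms L A n. p \<in> S \<or> Neg p \<in> S)}"

text \<open>
  A structure in a countable language is \<open>\<omega>\<close>-stable if its theory is: over every countable
  set of parameters in every model of the theory there are only countably many complete
  \<open>n\<close>-types, for every \<open>n\<close>.

  The models \<open>N\<close> range over the structures whose universe is a subset of the type \<open>'a\<close> that
  also hosts \<open>M\<close>.  This loses no generality.  By downward Loewenheim-Skolem, a countable
  subset \<open>A\<close> of a model lies in a countable elementary submodel, which realises the same
  finite sets of \<open>L(A)\<close>-formulas and so has the same types over \<open>A\<close>; hence only countable models
  matter.  If \<open>univ M\<close> is infinite, then so is \<open>'a\<close>, and every countable model is
  isomorphic to one inside \<open>'a\<close>; if \<open>univ M\<close> is finite, all models are isomorphic to \<open>M\<close>.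
\<close>

definition omega_stable :: "('f, 'r) language \<Rightarrow> ('f, 'r, 'a) fo_struct \<Rightarrow> bool" where
  "omega_stable L M \<longleftrightarrow>
     countable (Funs L) \<and> countable (Rels L) \<and> is_structure L M \<and>
     (\<forall>N. is_model L N (Th L M) \<longrightarrow>
        (\<forall>A \<subseteq> univ N. countable A \<longrightarrow> (\<forall>n. countable (complete_types L N A n))))"

text \<open>
  An \<open>\<omega>\<close>-stable group is a group, possibly with additional structure, whose theory is
  \<open>\<omega>\<close>-stable: the group \<open>G\<close> is the universe of \<open>M\<close>, and the binary function symbol \<open>m\<close> of \<open>L\<close>
  denotes its multiplication.  A pure group is the case where \<open>m\<close> is the only symbol; the identity
  and inversion are definable from \<open>m\<close>.
\<close>

definition omega_stable_group ::
    "('f, 'r) language \<Rightarrow> 'f \<Rightarrow> ('f, 'r, 'g) fo_struct \<Rightarrow> ('g, 'b) monoid_scheme \<Rightarrow> bool" where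
  "omega_stable_group L m M G \<longleftrightarrow>
     group G \<and> univ M = carrier G \<and> (m, 2) \<in> Funs L \<and>
     (\<forall>x \<in> carrier G. \<forall>y \<in> carrier G. Fint M m [x, y] = x \<otimes>\<^bsub>G\<^esub> y) \<and>
     omega_stable L M"


section \<open>Graphs and trees\<close>

record ('v, 'e) graph =
  verts :: "'v set"
  edges :: "'e set"
  origin :: "'e \<Rightarrow> 'v"
  terminus :: "'e \<Rightarrow> 'v"
  bar :: "'e \<Rightarrow> 'e"

definition is_graph :: "('v, 'e) graph \<Rightarrow> bool" where
  "is_graph T \<longleftrightarrow> (\<forall>e \<in> edges T.
     origin T e \<in> verts T \<and> terminus T e \<in> verts T \<and> bar T e \<in> edges T \<and>
     bar T (bar T e) = e \<and> bar T e \<noteq> e \<and> origin T e = terminus T (bar T e))"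

definition edge_path :: "('v, 'e) graph \<Rightarrow> 'e list \<Rightarrow> bool" where
  "edge_path T es \<longleftrightarrow> set es \<subseteq> edges T \<and>
     (\<forall>i. Suc i < length es \<longrightarrow> terminus T (es ! i) = origin T (es ! Suc i))"

definition connected_graph :: "('v, 'e) graph \<Rightarrow> bool" where
  "connected_graph T \<longleftrightarrow> (\<forall>v \<in> verts T. \<forall>w \<in> verts T. v = w \<or>
     (\<exists>es. es \<noteq> [] \<and> edge_path T es \<and> origin T (hd es) = v \<and> terminus T (last es) = w))"

text \<open>
  A circuit of length \<open>n \<ge> 1\<close> is a closed path through \<open>n\<close> distinct vertices without (cyclic)
  backtracking.  Loops (\<open>n = 1\<close>) and pairs of parallel edges (\<open>n = 2\<close>) give circuits; running
  back and forth along one geometric edge does not.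
\<close>

definition circuit :: "('v, 'e) graph \<Rightarrow> 'e list \<Rightarrow> bool" where
  "circuit T es \<longleftrightarrow> es \<noteq> [] \<and> edge_path T es \<and> terminus T (last es) = origin T (hd es) \<and>
     distinct (map (origin T) es) \<and>
     (\<forall>i < length es. es ! (Suc i mod length es) \<noteq> bar T (es ! i))"

text \<open>As usual, a tree has at least one vertex.\<close>

definition simplicial_tree :: "('v, 'e) graph \<Rightarrow> bool" where
  "simplicial_tree T \<longleftrightarrow>
     is_graph T \<and> verts T \<noteq> {} \<and> connected_graph T \<and> (\<nexists>es. circuit T es)"


section \<open>Group actions on graphs\<close>

text \<open>\<open>av\<close> and \<open>ae\<close> are the actions on vertices and on edges.\<close>

definition acts_on_graph ::
    "('g, 'b) monoid_scheme \<Rightarrow> ('v, 'e) graph \<Rightarrow> ('g \<Rightarrow> 'v \<Rightarrow> 'v) \<Rightarrow> ('g \<Rightarrow> 'e \<Rightarrow> 'e) \<Rightarrow> bool" where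
  "acts_on_graph G T av ae \<longleftrightarrow>
     group_action G (verts T) av \<and> group_action G (edges T) ae \<and>
     (\<forall>g \<in> carrier G. \<forall>e \<in> edges T.
        origin T (ae g e) = av g (origin T e) \<and>
        terminus T (ae g e) = av g (terminus T e) \<and>
        bar T (ae g e) = ae g (bar T e))"

definition inversion :: "('v, 'e) graph \<Rightarrow> ('g \<Rightarrow> 'e \<Rightarrow> 'e) \<Rightarrow> 'g \<Rightarrow> bool" where
  "inversion T ae g \<longleftrightarrow> (\<exists>e \<in> edges T. ae g e = bar T e)"

definition elliptic :: "('v, 'e) graph \<Rightarrow> ('g \<Rightarrow> 'v \<Rightarrow> 'v) \<Rightarrow> 'g \<Rightarrow> bool" where
  "elliptic T av g \<longleftrightarrow> (\<exists>v \<in> verts T. av g v = v)"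

definition hyperbolic ::
    "('v, 'e) graph \<Rightarrow> ('g \<Rightarrow> 'v \<Rightarrow> 'v) \<Rightarrow> ('g \<Rightarrow> 'e \<Rightarrow> 'e) \<Rightarrow> 'g \<Rightarrow> bool" where
  "hyperbolic T av ae g \<longleftrightarrow> \<not> inversion T ae g \<and> \<not> elliptic T av g"

definition trivial_action ::
    "('g, 'b) monoid_scheme \<Rightarrow> ('v, 'e) graph \<Rightarrow> ('g \<Rightarrow> 'v \<Rightarrow> 'v) \<Rightarrow> ('g \<Rightarrow> 'e \<Rightarrow> 'e) \<Rightarrow> bool" where
  "trivial_action G T av ae \<longleftrightarrow> \<not> (\<exists>g \<in> carrier G. hyperbolic T av ae g)"

end

theory Submission
  imports Defs
begin

text \<open>Let \<open>g\<close> be hyperbolic.  Its double centralizer \<open>A\<close> is a definable abelian group, so the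
  groups \<open>A ^ (2 ^ n)\<close> of \<open>2 ^ n\<close>-th powers form a descending chain of definable subgroups.  By
  \<open>\<omega>\<close>-stability the chain stabilizes at some \<open>n\<close>, hence \<open>g ^ (2 ^ n)\<close> has a \<open>2 ^ (n + k)\<close>-th
  root in \<open>A\<close> for every \<open>k\<close>.  But a hyperbolic element translates its axis by a positive integer
  \<open>l\<close>, which is multiplicative in powers: \<open>2 ^ (n + k)\<close> would divide the translation length of
  \<open>g ^ (2 ^ n)\<close> for every \<open>k\<close>.\<close>

section \<open>Descending chains of definable subgroups\<close>

text \<open>Fix a finite \<open>S0\<close> refuting \<open>insert p S\<close>. Whatever satisfies
  the part of \<open>S0\<close> inside \<open>S\<close> must fail \<open>p\<close>, and any finite
  subset of \<open>S\<close> can be satisfied along with that part.\<close>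

lemma finitely_satisfiable_insert_Neg:
  assumes fs: "finitely_satisfiable N S" and nfs: "\<not> finitely_satisfiable N (insert p S)"
  shows "finitely_satisfiable N (insert (Neg p) S)"
  unfolding finitely_satisfiable_def
proof (intro allI impI)
  fix S1 assume S1: "S1 \<subseteq> insert (Neg p) S" "finite S1"
  obtain S0 where S0: "S0 \<subseteq> insert p S" "finite S0"
    and un: "\<not> (\<exists>e. range e \<subseteq> univ N \<and> (\<forall>q \<in> S0. sat N e q))"
    using nfs unfolding finitely_satisfiable_def by blast
  have "(S0 - {p}) \<union> (S1 - {Neg p}) \<subseteq> S" "finite ((S0 - {p}) \<union> (S1 - {Neg p}))"
    using S0 S1 by auto
  then obtain e where e: "range e \<subseteq> univ N"
    and sat: "\<forall>q \<in> (S0 - {p}) \<union> (S1 - {Neg p}). sat N e q"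
    using fs unfolding finitely_satisfiable_def by meson
  have "\<not> sat N e p" using un e sat by blast
  then have "\<forall>q \<in> S1. sat N e q" using sat by auto
  then show "\<exists>e. range e \<subseteq> univ N \<and> (\<forall>q \<in> S1. sat N e q)" using e by blast
qed

text \<open>A finite subset of the union of a chain already lies in one member.\<close>

lemma finitely_satisfiable_Union_chain:
  assumes "\<C> \<noteq> {}" and "\<And>S S'. S \<in> \<C> \<Longrightarrow> S' \<in> \<C> \<Longrightarrow> S \<subseteq> S' \<or> S' \<subseteq> S"
    and fs: "\<And>S. S \<in> \<C> \<Longrightarrow> finitely_satisfiable N S"
  shows "finitely_satisfiable N (\<Union>\<C>)"
  unfolding finitely_satisfiable_def
proof (intro allI impI)
  fix S0 assume S0: "S0 \<subseteq> \<Union>\<C>" "finite S0"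
  have "subset.chain UNIV \<C>"
    using assms(2) by (auto simp: subset_chain_def)
  then obtain S where "S \<in> \<C>" "S0 \<subseteq> S"
    using finite_subset_Union_chain[OF S0(2,1) assms(1)] by blast
  then show "\<exists>e. range e \<subseteq> univ N \<and> (\<forall>p \<in> S0. sat N e p)"
    using fs S0(2) unfolding finitely_satisfiable_def by blast
qed

text \<open>By Zorn there is a maximal finitely satisfiable extension; it is complete because one of
  \<open>p\<close> and \<open>Neg p\<close> can always be added.\<close>

lemma extend_to_complete_type:
  assumes S: "S \<subseteq> forms L A n" and fs: "finitely_satisfiable N S"
  obtains S' where "S' \<in> complete_types L N A n" "S \<subseteq> S'"
proof -
  define \<A> where "\<A> = {S'. S \<subseteq> S' \<and> S' \<subseteq> forms L A n \<and> finitely_satisfiable N S'}"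
  have "\<exists>K\<in>\<A>. \<forall>X\<in>\<A>. K \<subseteq> X \<longrightarrow> X = K"
  proof (rule subset_Zorn_nonempty)
    show "\<A> \<noteq> {}" using assms by (auto simp: \<A>_def)
  next
    fix \<C> assume "\<C> \<noteq> {}" and "subset.chain \<A> \<C>"
    then have c: "\<C> \<subseteq> \<A>" "\<And>S S'. S \<in> \<C> \<Longrightarrow> S' \<in> \<C> \<Longrightarrow> S \<subseteq> S' \<or> S' \<subseteq> S"
      by (auto simp: subset_chain_def)
    have "finitely_satisfiable N (\<Union>\<C>)"
      using finitely_satisfiable_Union_chain[OF \<open>\<C> \<noteq> {}\<close> c(2)] c(1) by (auto simp: \<A>_def)
    moreover have "S \<subseteq> \<Union>\<C>" "\<Union>\<C> \<subseteq> forms L A n"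
      using c(1) \<open>\<C> \<noteq> {}\<close> by (auto simp: \<A>_def)
    ultimately show "\<Union>\<C> \<in> \<A>" by (simp add: \<A>_def)
  qed
  then obtain K where K: "S \<subseteq> K" "K \<subseteq> forms L A n" "finitely_satisfiable N K"
    and max: "\<And>X. X \<in> \<A> \<Longrightarrow> K \<subseteq> X \<Longrightarrow> X = K"
    by (auto simp: \<A>_def)
  have "p \<in> K \<or> Neg p \<in> K" if p: "p \<in> forms L A n" for p
  proof (cases "finitely_satisfiable N (insert p K)")
    case True
    then have "insert p K \<in> \<A>" using K p by (auto simp: \<A>_def)
    then show ?thesis using max by blast
  next
    case False
    have "Neg p \<in> forms L A n" using p by (simp add: forms_def)
    then have "insert (Neg p) K \<in> \<A>"
      using K finitely_satisfiable_insert_Neg[OF K(3) False] by (auto simp: \<A>_def)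
    then show ?thesis using max by blast
  qed
  then have "K \<in> complete_types L N A n" using K by (auto simp: complete_types_def)
  with K(1) that show thesis by blast
qed

section \<open>Trees of formulas with continuum many types\<close>

lemma uncountable_nat_sets: "uncountable (UNIV :: nat set set)"
  using Cantors_theorem[of "UNIV :: nat set"] by (simp add: uncountable_def)

text \<open>Each branch \<open>\<phi> X\<close> extends to a complete type \<open>S X\<close>. Two
  branches contain a contradictory pair of formulas, so they cannot share a type, and
  \<open>S\<close> injects the sets of naturals into the types.\<close>

lemma uncountable_complete_types:
  fixes \<phi> :: "nat set \<Rightarrow> nat \<Rightarrow> ('f, 'r, 'a) form"
  assumes form: "\<And>X n. \<phi> X n \<in> forms L A k"
    and cons: "\<And>X n. \<exists>e. range e \<subseteq> univ N \<and> (\<forall>i\<le>n. sat N e (\<phi> X i))"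
    and incons: "\<And>X Y. X \<noteq> Y \<Longrightarrow>
       \<exists>n. \<forall>e. range e \<subseteq> univ N \<longrightarrow> \<not> (sat N e (\<phi> X n) \<and> sat N e (\<phi> Y n))"
  shows "uncountable (complete_types L N A k)"
proof
  assume ct: "countable (complete_types L N A k)"
  have "\<exists>S. S \<in> complete_types L N A k \<and> range (\<phi> X) \<subseteq> S" for X
  proof -
    have "finitely_satisfiable N (range (\<phi> X))"
      unfolding finitely_satisfiable_def
    proof (intro allI impI)
      fix S0 assume S0: "S0 \<subseteq> range (\<phi> X)" "finite S0"
      then obtain I where I: "finite I" "S0 = \<phi> X ` I"
        using finite_subset_image[OF S0(2,1)] by blast
      obtain n where "\<forall>i\<in>I. i \<le> n"
        using I(1) unfolding finite_nat_set_iff_bounded_le by (elim exE)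
      then show "\<exists>e. range e \<subseteq> univ N \<and> (\<forall>p \<in> S0. sat N e p)"
        using cons[of n X] I(2) by blast
    qed
    then show ?thesis
      using extend_to_complete_type[of "range (\<phi> X)" L A k N] form by (metis image_subsetI)
  qed
  then obtain S where S: "\<And>X. S X \<in> complete_types L N A k" "\<And>X. range (\<phi> X) \<subseteq> S X"
    by metis
  have "inj S"
  proof (rule injI, rule ccontr)
    fix X Y assume eq: "S X = S Y" and "X \<noteq> Y"
    then obtain n where
      n: "\<And>e. range e \<subseteq> univ N \<Longrightarrow> \<not> (sat N e (\<phi> X n) \<and> sat N e (\<phi> Y n))"
      using incons by blast
    have "{\<phi> X n, \<phi> Y n} \<subseteq> S X" using S(2)[of X] S(2)[of Y] eq by auto
    moreover have "finitely_satisfiable N (S X)" using S(1) by (simp add: complete_types_def)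
    ultimately have "\<exists>e. range e \<subseteq> univ N \<and> (\<forall>p \<in> {\<phi> X n, \<phi> Y n}. sat N e p)"
      unfolding finitely_satisfiable_def by (meson finite.emptyI finite_insert)
    then show False using n by auto
  qed
  moreover have "countable (range S)"
    using ct S(1) by (metis countable_subset image_subsetI)
  ultimately show False
    using countable_image_inj_on uncountable_nat_sets by blast
qed

section \<open>The double centralizer and its first-order definition\<close>

text \<open>This is C(C(g)), which equals the centre of C(g) since \<open>g\<close> lies in
  C(g).\<close>

definition double_centralizer :: "('g, 'b) monoid_scheme \<Rightarrow> 'g \<Rightarrow> 'g set" where
  "double_centralizer G g = {x \<in> carrier G. \<forall>y \<in> carrier G.
     y \<otimes>\<^bsub>G\<^esub> g = g \<otimes>\<^bsub>G\<^esub> y \<longrightarrow> x \<otimes>\<^bsub>G\<^esub> y = y \<otimes>\<^bsub>G\<^esub> x}"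

text \<open>Variable 2 is the tested element and variable 3 the bound one; 0 and 1 stay free for the
  coset formulas. The universal implication is spelled out with \<open>Neg\<close>,
  \<open>Exi\<close> and \<open>Conj\<close>.\<close>

definition double_centralizer_form :: "'f \<Rightarrow> 'g \<Rightarrow> ('f, 'r, 'g) form" where
  "double_centralizer_form m g = Neg (Exi 3 (Conj
     (Equal (Fn m [Var 3, Par g]) (Fn m [Par g, Var 3]))
     (Neg (Equal (Fn m [Var 2, Var 3]) (Fn m [Var 3, Var 2])))))"

text \<open>The \<open>2 ^ n\<close>-th power of variable 2; repeated squaring uses no symbol but
  \<open>m\<close>.\<close>

primrec pow2_trm :: "'f \<Rightarrow> nat \<Rightarrow> ('f, 'g) trm" where
  "pow2_trm m 0 = Var 2"
| "pow2_trm m (Suc n) = Fn m [pow2_trm m n, pow2_trm m n]"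

section \<open>Chain condition in an \<omega>-stable group\<close>

context
  fixes L :: "('f, 'r) language" and m :: 'f and M :: "('f, 'r, 'g) fo_struct"
    and G :: "('g, 'b) monoid_scheme" (structure)
  assumes stable: "omega_stable_group L m M G"
begin

lemma is_group: "group G"
  using stable by (simp add: omega_stable_group_def)

interpretation group G by (rule is_group)

lemma univ_eq: "univ M = carrier G"
  using stable by (simp add: omega_stable_group_def)

lemma mult_symbol: "(m, 2) \<in> Funs L"
  using stable by (simp add: omega_stable_group_def)

lemma mult_symbol': "(m, Suc (Suc 0)) \<in> Funs L"
  using mult_symbol by (simp add: numeral_2_eq_2)

lemma Fint_mult: "x \<in> carrier G \<Longrightarrow> y \<in> carrier G \<Longrightarrow> Fint M m [x, y] = x \<otimes> y"
  using stable by (simp add: omega_stable_group_def)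

text \<open>\<open>M\<close> is a model of its own theory, so stability applies to \<open>M\<close>
  itself.\<close>

lemma countable_types:
  assumes "A \<subseteq> carrier G" "countable A"
  shows "countable (complete_types L M A n)"
proof -
  have "omega_stable L M"
    using stable by (simp add: omega_stable_group_def)
  moreover from this have "is_model L M (Th L M)"
    by (simp add: is_model_def Th_def omega_stable_def)
  ultimately show ?thesis
    using assms univ_eq unfolding omega_stable_def by metis
qed

text \<open>Branching at level \<open>n\<close> between the cosets of \<open>H (Suc n)\<close> containing \<open>1\<close> and
  \<open>a n \<in> H n - H (Suc n)\<close> makes the left cosets of the \<open>H n\<close> into a binary tree whose branches
  give continuum many types.\<close>

lemma no_descending_chain:
  fixes H :: "nat \<Rightarrow> 'g set" and p :: "nat \<Rightarrow> ('f, 'r, 'g) form"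
  assumes sub: "\<And>n. subgroup (H n) G"
    and desc: "\<And>n. H (Suc n) \<subset> H n"
    and A: "A \<subseteq> carrier G" "countable A"
    and p_ok: "\<And>n. form_ok L (p n)" "\<And>n. params (p n) \<subseteq> A" "\<And>n. free_vars (p n) \<subseteq> {1}"
    and p_sat: "\<And>n e. range e \<subseteq> carrier G \<Longrightarrow> sat M e (p n) \<longleftrightarrow> e 1 \<in> H n"
  shows False
proof -
  have "\<exists>x. x \<in> H n \<and> x \<notin> H (Suc n)" for n using desc[of n] by blast
  then obtain a where a: "\<And>n. a n \<in> H n" "\<And>n. a n \<notin> H (Suc n)" by metis
  have HG: "\<And>n x. x \<in> H n \<Longrightarrow> x \<in> carrier G" using sub subgroup.mem_carrier by metis
  have aG: "a n \<in> carrier G" for n using a(1) HG by blast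
  have mono: "H k \<subseteq> H n" if "n \<le> k" for n k
    using lift_Suc_antimono_le[of H] desc that by blast
  \<comment> \<open>\<open>c X n\<close> is the product, in increasing order, of the
    \<open>a i\<close> with \<open>i < n\<close> and \<open>i \<in> X\<close>: the node at level
    \<open>n\<close> of the branch \<open>X\<close>.\<close>
  define c :: "nat set \<Rightarrow> nat \<Rightarrow> 'g"
    where "c = (\<lambda>X. rec_nat \<one> (\<lambda>n x. if n \<in> X then x \<otimes> a n else x))"
  have c0: "c X 0 = \<one>" and cS: "c X (Suc n) = (if n \<in> X then c X n \<otimes> a n else c X n)" for X n
    by (auto simp: c_def)
  have cG: "c X n \<in> carrier G" for X n
    by (induction n) (auto simp: c0 cS aG)
  have c_cong: "c X n = c Y n" if "\<And>i. i < n \<Longrightarrow> i \<in> X \<longleftrightarrow> i \<in> Y" for X Y n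
    using that by (induction n) (auto simp: c0 cS)
  \<comment> \<open>The parameters naming the nodes. They are countably many, since
    \<open>c X n\<close> sees only the part of \<open>X\<close> below \<open>n\<close>.\<close>
  define C where "C = range (\<lambda>(X, n). c X n)"
  have "C \<subseteq> (\<lambda>(X, n). c X n) ` ({X. finite X} \<times> UNIV)"
  proof
    fix x assume "x \<in> C"
    then obtain X n where "x = c X n" by (auto simp: C_def)
    also have "c X n = c (X \<inter> {..<n}) n" by (rule c_cong) auto
    finally show "x \<in> (\<lambda>(X, n). c X n) ` ({X. finite X} \<times> UNIV)" by force
  qed
  moreover have "countable ((\<lambda>(X, n). c X n) ` ({X. finite X} \<times> (UNIV :: nat set)))"
    by (intro countable_image countable_SIGMA countable_Collect_finite) auto
  ultimately have "countable C" by (rule countable_subset)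
  \<comment> \<open>Variable 0 lies in the left coset of \<open>H n\<close> at the node
    \<open>c X n\<close>.\<close>
  define \<phi> :: "nat set \<Rightarrow> nat \<Rightarrow> ('f, 'r, 'g) form" where
    "\<phi> X n = Exi 1 (Conj (p n) (Equal (Var 0) (Fn m [Par (c X n), Var 1])))" for X n
  have sat_\<phi>: "sat M e (\<phi> X n) \<longleftrightarrow> (\<exists>y \<in> H n. e 0 = c X n \<otimes> y)"
    if e: "range e \<subseteq> carrier G" for e X n
  proof -
    have "sat M (e(1 := y)) (p n) \<longleftrightarrow> y \<in> H n" if "y \<in> carrier G" for y
      using p_sat[of "e(1 := y)" n] that e by auto
    then show ?thesis
      using HG by (auto simp: \<phi>_def univ_eq Fint_mult cG)
  qed
  have "uncountable (complete_types L M (A \<union> C) 1)"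
  proof (rule uncountable_complete_types)
    fix X n
    show "\<phi> X n \<in> forms L (A \<union> C) 1"
      using p_ok[of n] mult_symbol' by (auto simp: \<phi>_def forms_def C_def)
    \<comment> \<open>The cosets along a branch are nested, so \<open>c X n\<close> itself realizes
      the formulas of levels up to \<open>n\<close>.\<close>
    have branch: "\<exists>y \<in> H i. c X n = c X i \<otimes> y" if "i \<le> n" for i
      using that
    proof (induction n rule: dec_induct)
      case base
      show ?case
        by (rule bexI[of _ \<one>]) (use cG sub in \<open>auto intro: subgroup.one_closed\<close>)
    next
      case (step n)
      then obtain y where y: "y \<in> H i" "c X n = c X i \<otimes> y" by blast
      have "y \<otimes> a n \<in> H i"
        using y(1) a(1)[of n] mono[OF step(1)] by (intro subgroup.m_closed[OF sub]) auto
      moreover have "c X i \<otimes> y \<otimes> a n = c X i \<otimes> (y \<otimes> a n)"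
        using HG[OF y(1)] cG aG by (simp add: m_assoc)
      ultimately show ?case
        using y by (auto simp: cS)
    qed
    show "\<exists>e. range e \<subseteq> univ M \<and> (\<forall>i\<le>n. sat M e (\<phi> X i))"
      by (rule exI[of _ "\<lambda>_. c X n"]) (use cG branch in \<open>auto simp: univ_eq sat_\<phi>\<close>)
  next
    fix X Y :: "nat set" assume "X \<noteq> Y"
    then have "\<exists>n. \<not> (n \<in> X \<longleftrightarrow> n \<in> Y)" by blast
    then obtain n where n: "\<not> (n \<in> X \<longleftrightarrow> n \<in> Y)"
      and least: "\<And>i. i < n \<Longrightarrow> i \<in> X \<longleftrightarrow> i \<in> Y"
      using exists_least_iff[of "\<lambda>n. \<not> (n \<in> X \<longleftrightarrow> n \<in> Y)"] by blast
    \<comment> \<open>At the first difference \<open>n\<close> both branches sit at the same node.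
      One continues with \<open>a n\<close> and the other does not, and these cosets of
      \<open>H (Suc n)\<close> are disjoint as \<open>a n \<notin> H (Suc n)\<close>.\<close>
    have disj: "False" if "y \<in> H (Suc n)" "z \<in> H (Suc n)" "c X n \<otimes> a n \<otimes> y = c X n \<otimes> z"
      for X y z
    proof -
      have "a n \<otimes> y = z" using that HG aG cG by (simp add: m_assoc)
      then have "a n = z \<otimes> inv y" using that HG aG by (metis inv_solve_right)
      then show False
        using that(1,2) a(2) subgroup.m_closed[OF sub] subgroup.m_inv_closed[OF sub] by metis
    qed
    have "\<not> (sat M e (\<phi> X (Suc n)) \<and> sat M e (\<phi> Y (Suc n)))" if e: "range e \<subseteq> carrier G" for e
    proof
      assume "sat M e (\<phi> X (Suc n)) \<and> sat M e (\<phi> Y (Suc n))"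
      then obtain y z where yz: "y \<in> H (Suc n)" "z \<in> H (Suc n)"
        and "c X (Suc n) \<otimes> y = c Y (Suc n) \<otimes> z"
        using sat_\<phi>[OF e] by metis
      then show False
        using disj[OF yz, of X] disj[OF yz(2,1), of Y] n c_cong[OF least]
        by (auto simp: cS split: if_splits)
    qed
    then show "\<exists>n. \<forall>e. range e \<subseteq> univ M \<longrightarrow> \<not> (sat M e (\<phi> X n) \<and> sat M e (\<phi> Y n))"
      using univ_eq by metis
  qed
  moreover have "countable (complete_types L M (A \<union> C) 1)"
    by (rule countable_types) (use A \<open>countable C\<close> cG in \<open>auto simp: C_def\<close>)
  ultimately show False by blast
qed

section \<open>Iterated squares in the double centralizer\<close>

lemma trm_val_pow2: "e 2 \<in> carrier G \<Longrightarrow> trm_val M e (pow2_trm m n) = e 2 [^] ((2::nat) ^ n)"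
  by (induction n) (auto simp: Fint_mult nat_pow_mult mult_2)

lemma pow2_trm_syntax:
  "trm_ok L (pow2_trm m n)" "trm_params (pow2_trm m n) = {}" "trm_vars (pow2_trm m n) = {2}"
  by (induction n) (use mult_symbol' in auto)

text \<open>Since \<open>g\<close> commutes with itself, \<open>y\<close> commutes with
  \<open>g\<close>; hence \<open>y\<close> is among the elements with which \<open>x\<close> must
  commute.\<close>

lemma double_centralizer_commute:
  assumes "g \<in> carrier G" "x \<in> double_centralizer G g" "y \<in> double_centralizer G g"
  shows "x \<otimes> y = y \<otimes> x"
proof -
  have "y \<otimes> g = g \<otimes> y" using assms(1,3) unfolding double_centralizer_def by blast
  then show ?thesis using assms(2,3) unfolding double_centralizer_def by blast
qed

lemma subgroup_double_centralizer:
  assumes "g \<in> carrier G"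
  shows "subgroup (double_centralizer G g) G"
proof
  fix x y assume "x \<in> double_centralizer G g" "y \<in> double_centralizer G g"
  then show "x \<otimes> y \<in> double_centralizer G g" by (auto simp: double_centralizer_def) (metis m_assoc)
next
  fix x assume "x \<in> double_centralizer G g"
  moreover have "inv x \<otimes> y = y \<otimes> inv x"
    if "x \<in> carrier G" "y \<in> carrier G" "x \<otimes> y = y \<otimes> x" for y
  proof -
    have "inv x \<otimes> y = inv x \<otimes> (y \<otimes> x) \<otimes> inv x" using that(1,2) by (simp add: m_assoc)
    also have "\<dots> = inv x \<otimes> (x \<otimes> y) \<otimes> inv x" by (simp only: that(3))
    also have "\<dots> = y \<otimes> inv x" using that(1,2) by (simp flip: m_assoc)
    finally show ?thesis .
  qed
  ultimately show "inv x \<in> double_centralizer G g" by (simp add: double_centralizer_def)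
next
  show "\<one> \<in> double_centralizer G g" by (simp add: double_centralizer_def)
  show "double_centralizer G g \<subseteq> carrier G" unfolding double_centralizer_def by blast
qed

text \<open>On an abelian group taking \<open>2 ^ n\<close>-th powers is an endomorphism, so its
  image \<open>H n\<close> is a subgroup. A stable value of the chain supplies roots of every order
  \<open>2 ^ (n + k)\<close>.\<close>

lemma pow2_stabilizes:
  assumes g: "g \<in> carrier G"
  obtains n where "\<And>k. \<exists>h \<in> carrier G. g [^] ((2::nat) ^ n) = h [^] ((2::nat) ^ (n + k))"
proof -
  define H where "H n = (\<lambda>y. y [^] ((2::nat) ^ n)) ` double_centralizer G g" for n :: nat
  interpret D: subgroup "double_centralizer G g" G by (rule subgroup_double_centralizer[OF g])
  have sub: "subgroup (H n) G" for n
  proof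
    show "\<one> \<in> H n"
      unfolding H_def by (rule image_eqI[of _ _ \<one>]) auto
  next
    fix x y assume "x \<in> H n" "y \<in> H n"
    then obtain u v where "x = u [^] ((2::nat) ^ n)" "y = v [^] ((2::nat) ^ n)"
      "u \<in> double_centralizer G g" "v \<in> double_centralizer G g" unfolding H_def by blast
    then show "x \<otimes> y \<in> H n"
      unfolding H_def
      by (intro image_eqI[of _ _ "u \<otimes> v"])
        (auto simp: pow_mult_distrib double_centralizer_commute[OF g])
  next
    fix x assume "x \<in> H n"
    then show "inv x \<in> H n"
      unfolding H_def using D.m_inv_closed by (force simp flip: nat_pow_inv)
  qed (auto simp: H_def)
  \<comment> \<open>The exponent is split in two orders. Squaring last makes
    \<open>H (Suc n)\<close> a function of \<open>H n\<close>, so one equality propagates to all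
    later levels; squaring first, in \<open>desc\<close>, shows that the chain descends.\<close>
  have HSuc: "H (Suc n) = (\<lambda>y. y [^] (2::nat)) ` H n" for n
    by (auto simp: H_def image_image nat_pow_pow mult.commute)
  have desc: "H (Suc n) \<subseteq> H n" for n
  proof -
    have "y [^] ((2::nat) ^ Suc n) = (y [^] (2::nat)) [^] ((2::nat) ^ n)" if "y \<in> double_centralizer G g" for y
      using that by (simp add: nat_pow_pow)
    then show ?thesis
      unfolding H_def using D.m_closed by (auto simp: numeral_2_eq_2)
  qed
  \<comment> \<open>The bound variable 2 is the root; \<open>g\<close> is the only parameter, the
    same at every level.\<close>
  define p :: "nat \<Rightarrow> ('f, 'r, 'g) form" where
    "p n = Exi 2 (Conj (double_centralizer_form m g) (Equal (Var 1) (pow2_trm m n)))" for n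
  have p_sat: "sat M e (p n) \<longleftrightarrow> e 1 \<in> H n" if "range e \<subseteq> carrier G" for n e
  proof -
    have "sat M (e(2 := y)) (double_centralizer_form m g) \<longleftrightarrow> y \<in> double_centralizer G g" if "y \<in> carrier G" for y
    proof -
      have "sat M (e(2 := y)) (double_centralizer_form m g) \<longleftrightarrow> \<not> (\<exists>z \<in> carrier G.
          Fint M m [z, g] = Fint M m [g, z] \<and> Fint M m [y, z] \<noteq> Fint M m [z, y])"
        by (simp add: double_centralizer_form_def univ_eq)
      also have "\<dots> \<longleftrightarrow> \<not> (\<exists>z \<in> carrier G. z \<otimes> g = g \<otimes> z \<and> y \<otimes> z \<noteq> z \<otimes> y)"
        using Fint_mult[OF _ g] Fint_mult[OF g] Fint_mult[OF that] Fint_mult[OF _ that] by metis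
      also have "\<dots> \<longleftrightarrow> y \<in> double_centralizer G g" using that unfolding double_centralizer_def by blast
      finally show ?thesis .
    qed
    then show ?thesis
      using D.mem_carrier
      by (auto simp: p_def H_def univ_eq trm_val_pow2)
  qed
  have "\<exists>n. \<not> H (Suc n) \<subset> H n"
  proof (rule ccontr)
    assume "\<nexists>n. \<not> H (Suc n) \<subset> H n"
    then have "H (Suc n) \<subset> H n" for n by blast
    then show False
      by (rule no_descending_chain[where A = "{g}" and p = p, OF sub])
        (use g mult_symbol' p_sat in \<open>auto simp: p_def double_centralizer_form_def pow2_trm_syntax\<close>)
  qed
  then obtain n where n: "H (Suc n) = H n" using desc by blast
  have eq: "H (n + k) = H n" for k
    by (induction k) (use n HSuc in auto)
  have "g \<in> double_centralizer G g"
    unfolding double_centralizer_def by (intro CollectI conjI ballI impI) (rule g, erule sym)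
  then have "g [^] ((2::nat) ^ n) \<in> H n" by (simp add: H_def)
  then have "g [^] ((2::nat) ^ n) \<in> H (n + k)" for k using eq by simp
  then show thesis
    using that[of n] unfolding H_def by (meson D.mem_carrier imageE)
qed

end

section \<open>Translations of trees\<close>

text \<open>A recursive counterpart of \<open>edge_path\<close> that carries its endpoints and
  admits the empty walk, so that walks concatenate and suit induction.\<close>

primrec walk :: "('v, 'e) graph \<Rightarrow> 'v \<Rightarrow> 'e list \<Rightarrow> 'v \<Rightarrow> bool" where
  "walk T v [] w \<longleftrightarrow> v = w"
| "walk T v (e # es) w \<longleftrightarrow> e \<in> edges T \<and> origin T e = v \<and> walk T (terminus T e) es w"

abbreviation reduced :: "('v, 'e) graph \<Rightarrow> 'e list \<Rightarrow> bool" where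
  "reduced T \<equiv> successively (\<lambda>e f. f \<noteq> bar T e)"

lemma walk_append: "walk T v (p @ q) w \<longleftrightarrow> (\<exists>u. walk T v p u \<and> walk T u q w)"
  by (induction p arbitrary: v) auto

lemma walk_edges: "walk T v p w \<Longrightarrow> set p \<subseteq> edges T"
  by (induction p arbitrary: v) auto

lemma walk_iff_edge_path:
  "p \<noteq> [] \<Longrightarrow> walk T v p w \<longleftrightarrow>
     edge_path T p \<and> origin T (hd p) = v \<and> terminus T (last p) = w"
proof (induction p arbitrary: v)
  case (Cons e p)
  then show ?case
    by (cases p) (auto simp: edge_path_def nth_Cons split: nat.splits)
qed simp

lemma connected_walk:
  assumes "connected_graph T" "v \<in> verts T" "w \<in> verts T"
  obtains p where "walk T v p w"
proof (cases "v = w")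
  case True
  then show ?thesis using that[of "[]"] by simp
next
  case False
  then show ?thesis
    using assms that unfolding connected_graph_def by (metis walk_iff_edge_path)
qed

context
  fixes T :: "('v, 'e) graph"
  assumes graph: "is_graph T"
begin

lemma bar_simps:
  assumes "e \<in> edges T"
  shows "bar T e \<in> edges T" "bar T (bar T e) = e" "bar T e \<noteq> e"
    "terminus T (bar T e) = origin T e" "origin T (bar T e) = terminus T e"
  using assms graph unfolding is_graph_def by metis+

lemma endpoints_in_verts: "e \<in> edges T \<Longrightarrow> origin T e \<in> verts T \<and> terminus T e \<in> verts T"
  using graph unfolding is_graph_def by blast

lemma walk_rev: "walk T v p w \<Longrightarrow> walk T w (rev (map (bar T) p)) v"
  by (induction p arbitrary: v) (auto simp: walk_append bar_simps)

lemma reduced_rev: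
  assumes "set p \<subseteq> edges T" "reduced T p"
  shows "reduced T (rev (map (bar T) p))"
proof -
  have "successively (\<lambda>e f. bar T e \<noteq> bar T (bar T f)) p"
    using assms(2) by (rule successively_mono) (use assms(1) bar_simps in auto)
  then show ?thesis by (simp add: successively_map)
qed

text \<open>Reduce the tail first; then the leading edge either cancels against the head of the
  result or can be kept.\<close>

lemma reduce_walk:
  assumes "walk T v p w"
  shows "\<exists>q. walk T v q w \<and> reduced T q \<and> length q \<le> length p"
  using assms
proof (induction p arbitrary: v)
  case Nil
  then show ?case by (intro exI[of _ "[]"]) simp
next
  case (Cons e p)
  then obtain q where q: "walk T (terminus T e) q w" "reduced T q" "length q \<le> length p"
    by auto
  have e: "e \<in> edges T" "origin T e = v" using Cons.prems by auto
  show ?case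
  proof (cases "q \<noteq> [] \<and> hd q = bar T e")
    case True
    then obtain r where r: "q = bar T e # r" by (cases q) auto
    then have "walk T v r w" "reduced T r" "length r \<le> length (e # p)"
      using q e by (auto simp: bar_simps successively_Cons)
    then show ?thesis by blast
  next
    case False
    then have "walk T v (e # q) w" "reduced T (e # q)" "length (e # q) \<le> length (e # p)"
      using q e by (auto simp: successively_Cons)
    then show ?thesis by blast
  qed
qed

text \<open>A nonempty closed reduced walk of minimal length would be a circuit: cyclic backtracking
  or a repeated vertex would yield a shorter one.\<close>

lemma reduced_closed_walk_Nil:
  assumes "\<nexists>es. circuit T es" and "walk T v p v" and "reduced T p"
  shows "p = []"
  using assms(2,3)
proof (induction p arbitrary: v rule: length_induct)
  case (1 p)
  note walk = \<open>walk T v p v\<close> and red = \<open>reduced T p\<close>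
  have IH: "q = []" if "length q < length p" "walk T u q u" "reduced T q" for q u
    using 1 that by blast
  show ?case
  proof (rule ccontr)
    assume ne: "p \<noteq> []"
    \<comment> \<open>\<open>reduced\<close> does not compare the last edge with the first. If these
      cancel, the walk \<open>r\<close> between them is closed and reduced, hence empty, and then
      \<open>p\<close> backtracks in its middle.\<close>
    have hd_last: "hd p \<noteq> bar T (last p)"
    proof
      assume eq: "hd p = bar T (last p)"
      obtain e q where p: "p = e # q" using ne by (cases p) auto
      then have e: "e \<in> edges T" using walk by simp
      have "q \<noteq> []" using eq p e bar_simps(3)[OF e] by auto
      then obtain r f where q: "q = r @ [f]" by (cases q rule: rev_cases) auto
      then have f: "f \<in> edges T" "e = bar T f" using walk eq p by (auto simp: walk_append)
      have "walk T (terminus T e) r (terminus T e)"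
        using walk f by (auto simp: p q walk_append bar_simps)
      moreover have "reduced T r"
        using red by (auto simp: p q successively_append_iff successively_Cons)
      ultimately have "r = []" using IH p q by simp
      then show False using red f by (simp add: p q bar_simps)
    qed
    \<comment> \<open>The piece \<open>e # p2\<close> between two visits to \<open>y\<close> is
      closed, reduced, nonempty and shorter than \<open>p\<close>.\<close>
    have "distinct (map (origin T) p)"
    proof (rule ccontr)
      assume "\<not> distinct (map (origin T) p)"
      then obtain xs ys zs y where "map (origin T) p = xs @ y # ys @ y # zs"
        using not_distinct_decomp by fastforce
      then obtain p1 r where r: "p = p1 @ r" "map (origin T) r = y # ys @ y # zs"
        unfolding map_eq_append_conv by metis
      then obtain e p' where p': "r = e # p'" "origin T e = y"
          and "map (origin T) p' = ys @ y # zs"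
        by auto
      then obtain p2 s where s: "p' = p2 @ s" "map (origin T) s = y # zs"
        unfolding map_eq_append_conv by metis
      then obtain f p3 where f: "s = f # p3" "origin T f = y" by auto
      have p: "p = p1 @ (e # p2) @ (f # p3)" and y: "origin T e = y" "origin T f = y"
        using r(1) p' s(1) f by auto
      have "walk T y (e # p2) y" using walk y by (auto simp: p walk_append)
      moreover have "reduced T (e # p2)"
        using red successively_append_iff[of _ "e # p2" "f # p3"] unfolding p
        by (simp add: successively_append_iff)
      ultimately show False using IH[of "e # p2"] p by simp
    qed
    moreover have "p ! (Suc i mod length p) \<noteq> bar T (p ! i)" if "i < length p" for i
    proof (cases "Suc i < length p")
      case True
      then show ?thesis using red by (simp add: successively_conv_nth)
    next
      case False
      then have "Suc i = length p" using that by simp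
      then have "i = length p - 1" by simp
      with \<open>Suc i = length p\<close> show ?thesis
        using hd_last ne by (simp add: hd_conv_nth last_conv_nth)
    qed
    ultimately have "circuit T p"
      using walk ne by (auto simp: circuit_def walk_iff_edge_path)
    then show False using assms(1) by blast
  qed
qed

text \<open>Strip common first edges. Once the first edges differ, the reverse of one walk followed
  by the other is a nonempty closed reduced walk.\<close>

lemma reduced_walk_unique:
  assumes nc: "\<nexists>es. circuit T es"
  shows "walk T v p w \<Longrightarrow> reduced T p \<Longrightarrow> walk T v q w \<Longrightarrow> reduced T q \<Longrightarrow> p = q"
proof (induction p arbitrary: v q)
  case Nil
  then show ?case using reduced_closed_walk_Nil[OF nc, of w q] by simp
next
  case (Cons e p)
  show ?case
  proof (cases q)
    case Nil
    then show ?thesis using Cons.prems reduced_closed_walk_Nil[OF nc, of w "e # p"] by simp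
  next
    case (Cons f r)
    show ?thesis
    proof (cases "f = e")
      case True
      then show ?thesis
        using Cons.prems Cons.IH[of "terminus T e" r] \<open>q = f # r\<close>
        by (auto simp: successively_Cons)
    next
      case False
      let ?c = "rev (map (bar T) (e # p)) @ q"
      have "walk T w ?c w"
        using walk_rev[OF Cons.prems(1)] Cons.prems(3) unfolding walk_append by blast
      moreover have "reduced T ?c"
        using reduced_rev[OF walk_edges[OF Cons.prems(1)] Cons.prems(2)] Cons.prems(1,4) False
          \<open>q = f # r\<close>
        by (auto simp: successively_append_iff bar_simps)
      ultimately have "?c = []" by (rule reduced_closed_walk_Nil[OF nc])
      then show ?thesis by simp
    qed
  qed
qed

lemma reduced_walk_shortest:
  assumes "\<nexists>es. circuit T es" "walk T v p w" "reduced T p" "walk T v q w"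
  shows "length p \<le> length q"
  using reduce_walk[OF assms(4)] reduced_walk_unique[OF assms(1-3)] by blast

end

section \<open>Axes and translation lengths\<close>

text \<open>Abstracts the action of one group element; injectivity on edges lets \<open>k\<close>
  preserve reduced walks.\<close>

definition graph_endo :: "('v, 'e) graph \<Rightarrow> ('v \<Rightarrow> 'v) \<Rightarrow> ('e \<Rightarrow> 'e) \<Rightarrow> bool" where
  "graph_endo T f k \<longleftrightarrow> f ` verts T \<subseteq> verts T \<and> k ` edges T \<subseteq> edges T \<and> inj_on k (edges T) \<and>
     (\<forall>e \<in> edges T. origin T (k e) = f (origin T e) \<and> terminus T (k e) = f (terminus T e) \<and>
        bar T (k e) = k (bar T e))"

lemma walk_map:
  assumes "graph_endo T f k" "walk T v p w"
  shows "walk T (f v) (map k p) (f w)"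
  using assms(2)
  by (induction p arbitrary: v) (use assms(1) in \<open>auto simp: graph_endo_def\<close>)

lemma walk_funpow:
  assumes "graph_endo T f k" "walk T v p w"
  shows "\<exists>q. walk T ((f ^^ n) v) q ((f ^^ n) w) \<and> length q = length p"
proof (induction n)
  case 0
  then show ?case using assms(2) by auto
next
  case (Suc n)
  then show ?case using walk_map[OF assms(1)] by (metis funpow.simps(2) comp_apply length_map)
qed

lemma reduced_map:
  assumes "is_graph T" "graph_endo T f k" "set p \<subseteq> edges T" "reduced T p"
  shows "reduced T (map k p)"
  unfolding successively_map
proof (rule successively_mono[OF assms(4)])
  fix e e' assume "e \<in> set p" "e' \<in> set p" "e' \<noteq> bar T e"
  then have "e \<in> edges T" "e' \<in> edges T" "bar T e \<in> edges T"
    using assms(1,3) by (auto simp: bar_simps)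
  then show "k e' \<noteq> bar T (k e)"
    using assms(2) \<open>e' \<noteq> bar T e\<close> unfolding graph_endo_def by (metis inj_onD)
qed

text \<open>A vertex \<open>v\<close> with \<open>d(v, f v)\<close> minimal lies on the axis of \<open>f\<close>: the translates of a shortest
  walk from \<open>v\<close> to \<open>f v\<close> concatenate to reduced walks, since backtracking at \<open>f v\<close> would bring
  the next vertex closer to its image.\<close>

lemma ex_axis:
  assumes graph: "is_graph T" and conn: "connected_graph T" and ne: "verts T \<noteq> {}"
    and endo: "graph_endo T f k"
    and no_fix: "\<And>v. v \<in> verts T \<Longrightarrow> f v \<noteq> v"
    and no_inv: "\<And>e. e \<in> edges T \<Longrightarrow> k e \<noteq> bar T e"
  obtains v l where "v \<in> verts T" "0 < l"
    "\<And>n. \<exists>q. walk T v q ((f ^^ n) v) \<and> reduced T q \<and> length q = n * l"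
proof -
  \<comment> \<open>The least \<open>l\<close> with \<open>P l\<close> is the minimal displacement
    of a vertex; it becomes the translation length.\<close>
  define P where "P l \<longleftrightarrow> (\<exists>v p. v \<in> verts T \<and> walk T v p (f v) \<and> length p = l)" for l
  obtain v0 where "v0 \<in> verts T" using ne by blast
  moreover from this have "f v0 \<in> verts T" using endo by (auto simp: graph_endo_def)
  ultimately obtain p0 where "walk T v0 p0 (f v0)" using connected_walk[OF conn] by metis
  with \<open>v0 \<in> verts T\<close> have "\<exists>l. P l" unfolding P_def by blast
  then obtain l where "P l" and min: "\<And>l'. P l' \<Longrightarrow> l \<le> l'"
    by (metis LeastI Least_le)
  then obtain v p' where v: "v \<in> verts T" and p': "walk T v p' (f v)" "length p' = l"
    unfolding P_def by blast
  obtain p where p: "walk T v p (f v)" "reduced T p" "length p \<le> length p'"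
    using reduce_walk[OF graph p'(1)] by blast
  have "P (length p)" using v p(1) unfolding P_def by blast
  then have len: "length p = l" using min p(3) p'(2) by force
  have "p \<noteq> []" using p(1) no_fix[OF v] by auto
  have turn: "k (hd p) \<noteq> bar T (last p)"
  proof
    assume eq: "k (hd p) = bar T (last p)"
    obtain e q where pe: "p = e # q" using \<open>p \<noteq> []\<close> by (cases p) auto
    then have e: "e \<in> edges T" using p(1) by simp
    \<comment> \<open>A one-edge walk \<open>p\<close> would consist of an edge inverted by
      \<open>k\<close>.\<close>
    have "q \<noteq> []" using eq pe no_inv[OF e] by auto
    then obtain r e' where q: "q = r @ [e']" by (cases q rule: rev_cases) auto
    then have e': "e' \<in> edges T" "k e = bar T e'" using p(1) eq pe by (auto simp: walk_append)
    have "f (terminus T e) = origin T e'"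
      using endo e e' bar_simps(4)[OF graph e'(1)] unfolding graph_endo_def by metis
    then have "walk T (terminus T e) r (f (terminus T e))"
      using p(1) by (auto simp: pe q walk_append)
    moreover have "terminus T e \<in> verts T" using endpoints_in_verts[OF graph e] by blast
    ultimately have "P (length r)" unfolding P_def by blast
    then have "l \<le> length r" by (rule min)
    then show False using len pe q by simp
  qed
  \<comment> \<open>The clause on \<open>hd q\<close> strengthens the induction: the new junction
    lies between \<open>last p\<close> and \<open>k (hd q)\<close>, and \<open>turn\<close> only
    speaks of \<open>k (hd p)\<close>.\<close>
  have "\<exists>q. walk T v q ((f ^^ n) v) \<and> reduced T q \<and> length q = n * l \<and>
      (q \<noteq> [] \<longrightarrow> hd q = hd p)" for n
  proof (induction n)
    case 0
    then show ?case by (intro exI[of _ "[]"]) simp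
  next
    case (Suc n)
    then obtain q where q: "walk T v q ((f ^^ n) v)" "reduced T q" "length q = n * l"
      "q \<noteq> [] \<longrightarrow> hd q = hd p" by blast
    have "walk T v (p @ map k q) ((f ^^ Suc n) v)"
      using p(1) walk_map[OF endo q(1)] by (auto simp: walk_append)
    moreover have "reduced T (p @ map k q)"
      using p(2) reduced_map[OF graph endo walk_edges[OF q(1)] q(2)] q(4) turn
      by (auto simp: successively_append_iff hd_map)
    moreover have "length (p @ map k q) = Suc n * l" using q(3) len by simp
    ultimately show ?case using \<open>p \<noteq> []\<close> by (metis hd_append2)
  qed
  moreover have "0 < l" using len \<open>p \<noteq> []\<close> by auto
  ultimately show thesis using that v by metis
qed

text \<open>Makes \<open>l\<close> the limit of d(v, f^n v) / n. The error \<open>D\<close> may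
  depend on \<open>w\<close> but not on \<open>n\<close>, so it is negligible for large
  \<open>n\<close>.\<close>

definition translates :: "('v, 'e) graph \<Rightarrow> ('v \<Rightarrow> 'v) \<Rightarrow> 'v \<Rightarrow> nat \<Rightarrow> bool" where
  "translates T f v l \<longleftrightarrow> v \<in> verts T \<and> 0 < l \<and>
     (\<forall>n. \<exists>q. walk T v q ((f ^^ n) v) \<and> length q = n * l) \<and>
     (\<forall>w \<in> verts T. \<exists>D. \<forall>n q. walk T w q ((f ^^ n) w) \<longrightarrow> n * l \<le> length q + D)"

text \<open>Going from \<open>v\<close> to \<open>w\<close>, along \<open>q\<close>, and back by the
  translate of the first piece joins \<open>v\<close> to its image in the tree. This cannot beat the
  reduced walk of length \<open>n * l\<close>, so \<open>D\<close> is twice the length of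
  \<open>p\<close>.\<close>

lemma ex_translates:
  assumes tree: "simplicial_tree T" and endo: "graph_endo T f k"
    and no_fix: "\<And>v. v \<in> verts T \<Longrightarrow> f v \<noteq> v"
    and no_inv: "\<And>e. e \<in> edges T \<Longrightarrow> k e \<noteq> bar T e"
  shows "\<exists>v l. translates T f v l"
proof -
  have graph: "is_graph T" and conn: "connected_graph T" and ne: "verts T \<noteq> {}"
    and nc: "\<nexists>es. circuit T es"
    using tree by (auto simp: simplicial_tree_def)
  obtain v l where v: "v \<in> verts T" and l: "0 < l"
    and axis: "\<And>n. \<exists>q. walk T v q ((f ^^ n) v) \<and> reduced T q \<and> length q = n * l"
    using ex_axis[OF graph conn ne endo no_fix no_inv] by metis
  have "\<exists>D. \<forall>n q. walk T w q ((f ^^ n) w) \<longrightarrow> n * l \<le> length q + D" if w: "w \<in> verts T" for w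
  proof -
    obtain p where p: "walk T v p w" using connected_walk[OF conn v w] by blast
    have "n * l \<le> length q + 2 * length p" if q: "walk T w q ((f ^^ n) w)" for n q
    proof -
      obtain r where r: "walk T ((f ^^ n) w) r ((f ^^ n) v)" "length r = length p"
        using walk_funpow[OF endo walk_rev[OF graph p]] by fastforce
      obtain s where s: "walk T v s ((f ^^ n) v)" "reduced T s" "length s = n * l"
        using axis by blast
      have "walk T v (p @ q @ r) ((f ^^ n) v)" using p q r(1) unfolding walk_append by blast
      then have "length s \<le> length (p @ q @ r)" by (rule reduced_walk_shortest[OF graph nc s(1,2)])
      then show ?thesis using s(3) r(2) by simp
    qed
    then show ?thesis by blast
  qed
  then have "translates T f v l" using v l axis unfolding translates_def by blast
  then show ?thesis by blast
qed

section \<open>Roots of hyperbolic elements\<close>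

lemma graph_endo_action:
  assumes act: "acts_on_graph G T av ae" and g: "g \<in> carrier G"
  shows "graph_endo T (av g) (ae g)"
  using assms group_action.surj_prop[of G "verts T" av g] group_action.surj_prop[of G "edges T" ae g]
    group_action.inj_prop[of G "edges T" ae g]
  unfolding graph_endo_def acts_on_graph_def by blast

lemma action_nat_pow:
  assumes act: "group_action G E \<phi>" and g: "g \<in> carrier G" and x: "x \<in> E"
  shows "\<phi> (g [^]\<^bsub>G\<^esub> (n::nat)) x = (\<phi> g ^^ n) x"
proof -
  interpret group_action G E \<phi> by (rule act)
  interpret group G using group_hom group_hom.axioms(1) by auto
  show ?thesis
    using x
  proof (induction n arbitrary: x)
    case 0
    then show ?case by (metis id_eq_one restrict_apply' nat_pow_0 funpow_0)
  next
    case (Suc n)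
    have "\<phi> g x \<in> E" using element_image[OF g Suc.prems] by blast
    then show ?case
      using Suc g composition_rule[OF Suc.prems nat_pow_closed[OF g] g]
      by (simp add: funpow_swap1)
  qed
qed

text \<open>A root \<open>h\<close> is again hyperbolic, with some translation length
  \<open>l' \<ge> 1\<close>. Comparing displacements under the common power bounds
  \<open>b * l'\<close> by \<open>a * l\<close>, where \<open>l\<close> depends on \<open>g\<close>
  alone.\<close>

lemma hyperbolic_root:
  fixes G (structure)
  assumes tree: "simplicial_tree T" and act: "acts_on_graph G T av ae"
    and g: "g \<in> carrier G" "hyperbolic T av ae g"
  obtains l :: nat where "0 < l"
    "\<And>h a b. h \<in> carrier G \<Longrightarrow> g [^] (a::nat) = h [^] (b::nat) \<Longrightarrow> 0 < a \<Longrightarrow> even b \<Longrightarrow>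
      b \<le> a * l"
proof -
  have actv: "group_action G (verts T) av" and graph: "is_graph T"
    using act tree by (auto simp: acts_on_graph_def simplicial_tree_def)
  interpret group G using actv group_action.group_hom group_hom.axioms(1) by blast
  have translation: "\<exists>v l. translates T (av h) v l"
    if "h \<in> carrier G" "hyperbolic T av ae h" for h
    by (rule ex_translates[OF tree graph_endo_action[OF act that(1)]])
      (use that(2) in \<open>auto simp: hyperbolic_def elliptic_def inversion_def\<close>)
  obtain v l where v: "v \<in> verts T" and l: "0 < l"
    and axis: "\<And>n. \<exists>q. walk T v q ((av g ^^ n) v) \<and> length q = n * l"
    and far: "\<And>w. w \<in> verts T \<Longrightarrow>
      \<exists>D. \<forall>n q. walk T w q ((av g ^^ n) w) \<longrightarrow> n * l \<le> length q + D"
    using translation[OF g] unfolding translates_def by blast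
  have "b \<le> a * l"
    if h: "h \<in> carrier G" and eq: "g [^] a = h [^] b" and a: "0 < a" and b: "even b"
    for h and a b :: nat
  proof -
    have iter: "(av g ^^ (a * i)) w = (av h ^^ (b * i)) w" if "w \<in> verts T" for i w
      using action_nat_pow[OF actv g(1) that, of "a * i"] action_nat_pow[OF actv h that, of "b * i"]
        eq g(1) h by (metis nat_pow_pow)
    have "hyperbolic T av ae h"
    proof (rule ccontr)
      assume nh: "\<not> hyperbolic T av ae h"
      \<comment> \<open>An inversion swaps the ends of its edge, so the square of a non-hyperbolic
        \<open>h\<close> fixes a vertex. As \<open>b\<close> is even, every
        \<open>g ^ (a * i)\<close> then fixes it too.\<close>
      have "\<exists>w \<in> verts T. av h (av h w) = w"
      proof (cases "elliptic T av h")
        case True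
        then show ?thesis unfolding elliptic_def by metis
      next
        case False
        then obtain e where e: "e \<in> edges T" "ae h e = bar T e"
          using nh by (auto simp: hyperbolic_def inversion_def)
        have "av h (origin T e) = terminus T e" "av h (terminus T e) = origin T e"
          using act h e bar_simps[OF graph e(1)] unfolding acts_on_graph_def by metis+
        then show ?thesis using endpoints_in_verts[OF graph e(1)] by metis
      qed
      then obtain w where w: "w \<in> verts T" "(av h ^^ 2) w = w" by (auto simp: numeral_2_eq_2)
      have "(av h ^^ (2 * i)) w = w" for i
        using w(2) by (induction i) (auto simp: funpow_add numeral_2_eq_2)
      then have fix_w: "(av g ^^ (a * i)) w = w" for i
        using b iter[OF w(1)] by (metis dvd_mult2 dvdE)
      obtain D where D: "\<And>n q. walk T w q ((av g ^^ n) w) \<Longrightarrow> n * l \<le> length q + D"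
        using far[OF w(1)] by blast
      \<comment> \<open>The empty walk joins \<open>w\<close> to its fixed image, and
        \<open>Suc D\<close> rounds exceed the allowed error \<open>D\<close>.\<close>
      have "a * Suc D * l \<le> D" using D[of "[]" "a * Suc D"] fix_w[of "Suc D"] by (simp del: mult_Suc_right)
      moreover have "Suc D * 1 \<le> Suc D * (a * l)" using a l by (intro mult_le_mono2) simp
      moreover have "Suc D * (a * l) = a * Suc D * l" by (simp only: ac_simps)
      ultimately have "Suc D \<le> D" by (metis le_trans mult_1_right)
      then show False by simp
    qed
    then obtain l' where l': "0 < l'"
      and far': "\<And>w. w \<in> verts T \<Longrightarrow>
        \<exists>D. \<forall>n q. walk T w q ((av h ^^ n) w) \<longrightarrow> n * l' \<le> length q + D"
      using translation[OF h] unfolding translates_def by blast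
    obtain D where D: "\<And>n q. walk T v q ((av h ^^ n) v) \<Longrightarrow> n * l' \<le> length q + D"
      using far'[OF v] by blast
    \<comment> \<open>Repeating \<open>Suc D\<close> times absorbs the error: dividing by
      \<open>Suc D\<close> leaves less than one unit, which integrality removes.\<close>
    obtain q where "walk T v q ((av g ^^ (a * Suc D)) v)" "length q = a * Suc D * l"
      using axis by blast
    then have le: "b * Suc D * l' \<le> a * Suc D * l + D" using D iter[OF v] by metis
    have "Suc D * b * 1 \<le> Suc D * b * l'" using l' by (intro mult_le_mono2) simp
    also have "\<dots> = b * Suc D * l'" by (simp only: mult.commute)
    also note le
    also have "a * Suc D * l + D = Suc D * (a * l) + D" by (simp only: ac_simps)
    also have "\<dots> < Suc D * Suc (a * l)" by simp
    finally have "b < Suc (a * l)" by (simp only: mult_1_right mult_less_cancel1)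
    then show ?thesis by simp
  qed
  then show thesis using that l by blast
qed

theorem theorem1p1:
  fixes G :: "('g, 'b) monoid_scheme"
    and L :: "('f, 'r) language" and m :: 'f and M :: "('f, 'r, 'g) fo_struct"
    and T :: "('v, 'e) graph"
    and av :: "'g \<Rightarrow> 'v \<Rightarrow> 'v" and ae :: "'g \<Rightarrow> 'e \<Rightarrow> 'e"
  assumes "omega_stable_group L m M G"
    and "simplicial_tree T"
    and "acts_on_graph G T av ae"
  shows "trivial_action G T av ae \<and>
    (\<forall>g \<in> carrier G. inversion T ae g \<or> elliptic T av g)"
proof -
  have "\<not> hyperbolic T av ae g" if g: "g \<in> carrier G" for g
  proof
    assume hyp: "hyperbolic T av ae g"
    obtain l :: nat where l: "0 < l"
      and root: "\<And>h a b. h \<in> carrier G \<Longrightarrow> g [^]\<^bsub>G\<^esub> (a::nat) = h [^]\<^bsub>G\<^esub> (b::nat) \<Longrightarrow>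
        0 < a \<Longrightarrow> even b \<Longrightarrow> b \<le> a * l"
      using hyperbolic_root[OF assms(2,3) g hyp] by blast
    obtain n where "\<And>k. \<exists>h \<in> carrier G. g [^]\<^bsub>G\<^esub> ((2::nat) ^ n) = h [^]\<^bsub>G\<^esub> ((2::nat) ^ (n + k))"
      using pow2_stabilizes[OF assms(1) g] by blast
    \<comment> \<open>The choice \<open>k = l\<close> suffices: the root bound becomes
      \<open>2 ^ l \<le> l\<close>. Since \<open>0 < l\<close>, the exponent
      \<open>2 ^ (n + l)\<close> is even, as the bound requires.\<close>
    then obtain h where "h \<in> carrier G"
      "g [^]\<^bsub>G\<^esub> ((2::nat) ^ n) = h [^]\<^bsub>G\<^esub> ((2::nat) ^ (n + l))" by blast
    then have "(2::nat) ^ (n + l) \<le> 2 ^ n * l" using root l by simp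
    then have "(2::nat) ^ l \<le> l" by (simp add: power_add)
    then show False using less_exp[of l] by simp
  qed
  then show ?thesis by (auto simp: trivial_action_def hyperbolic_def)
qed

end
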